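(* Let $a\in\mathbb{R}$, $n\in\mathbb{Z}_+$, $\alpha>0$, let $w:\mathbb{N}_a\to\mathbb{R}\setminus\{0\}$ satisfy $\frac{w(a)}{w(k)}>0$ for all $k\in\mathbb{N}_{a+1}$, and let $u,v:\mathbb{N}_{a+1}\to\mathbb{R}^n$. Then for all $k\in\mathbb{N}_{a+1}$, $$\Big\{{}_a^{\rm G}\nabla_k^{-\alpha,w(k)}[u^{\rm T}(k)v(k)]\Big\}^2\le {}_a^{\rm G}\nabla_k^{-\alpha,w(k)}[u^{\rm T}(k)u(k)]\;\cdot\;{}_a^{\rm G}\nabla_k^{-\alpha,w(k)}[v^{\rm T}(k)v(k)].$$
   Context: For $a\in\mathbb{R}$, $\mathbb{N}_a:=\{a,a+1,a+2,\dots\}$. The rising function is $p^{\overline{q}}:=\frac{\Gamma(p+q)}{\Gamma(p)}$. For $\alpha>0$ and $k\in\mathbb{N}_{a+1}$, the Grünwald–Letnikov fractional sum is ${}_a^{\rm G}\nabla_k^{-\alpha}x(k):=\sum_{j=a+1}^{k}\frac{(k-j+1)^{\overline{\alpha-1}}}{\Gamma(\alpha)}x(j)$, and the tempered sum is ${}_a^{\rm G}\nabla_k^{-\alpha,w(k)}x(k):=w^{-1}(k)\,{}_a^{\rm G}\nabla_k^{-\alpha}[w(k)x(k)]=\sum_{j=a+1}^{k}\frac{(k-j+1)^{\overline{\alpha-1}}}{\Gamma(\alpha)}\frac{w(j)}{w(k)}x(j)$. *)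

theory Defs
  imports "HOL-Analysis.Analysis"
begin

definition nats_from :: "real \<Rightarrow> real set" where
  "nats_from a = {a + real m | m. True}"

definition rising :: "real \<Rightarrow> real \<Rightarrow> real" where
  "rising p q = Gamma (p + q) / Gamma p"

text \<open>
  Discrete-time signals are total functions on the reals of which only the values on
  \<^term>\<open>nats_from a\<close> or \<^term>\<open>nats_from (a + 1)\<close> matter. The summation index
  runs through \<open>a + 1, a + 2, \<dots>, k\<close>; the parameter \<open>\<alpha> > 0\<close> is the order of summation,
  i.e. \<open>GL_sum a \<alpha>\<close> is the nabla operator with exponent \<open>-\<alpha>\<close>.
\<close>

definition GL_sum :: "real \<Rightarrow> real \<Rightarrow> (real \<Rightarrow> real) \<Rightarrow> real \<Rightarrow> real" where
  "GL_sum a \<alpha> x k =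
     (\<Sum>j\<in>{j \<in> nats_from (a + 1). j \<le> k}. rising (k - j + 1) (\<alpha> - 1) / Gamma \<alpha> * x j)"

definition tempered_GL_sum ::
  "real \<Rightarrow> real \<Rightarrow> (real \<Rightarrow> real) \<Rightarrow> (real \<Rightarrow> real) \<Rightarrow> real \<Rightarrow> real" where
  "tempered_GL_sum a \<alpha> w x k = inverse (w k) * GL_sum a \<alpha> (\<lambda>j. w j * x j) k"

lemma finite_nats_from_le: "finite {j \<in> nats_from a. j \<le> k}"
proof (rule finite_subset)
  show "{j \<in> nats_from a. j \<le> k} \<subseteq> (\<lambda>m. a + real m) ` {..nat \<lfloor>k - a\<rfloor>}"
    by (auto simp: nats_from_def image_iff le_nat_floor algebra_simps)
qed simp

lemma tempered_GL_sum_eq: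
  "tempered_GL_sum a \<alpha> w x k =
     (\<Sum>j\<in>{j \<in> nats_from (a + 1). j \<le> k}.
        rising (k - j + 1) (\<alpha> - 1) / Gamma \<alpha> * (w j / w k) * x j)"
  by (simp add: tempered_GL_sum_def GL_sum_def sum_distrib_left divide_inverse mult_ac)

end

theory Submission
  imports Defs
begin

text \<open>
  The tempered sum at \<open>k\<close> is a finite weighted sum whose weight at \<open>j\<close> is the product of
  \<open>\<Gamma>(k - j + \<alpha>) / (\<Gamma>(k - j + 1) \<Gamma>(\<alpha>))\<close> and \<open>w j / w k\<close>. The first factor is positive since
  \<open>j \<le> k\<close> and \<open>\<alpha> > 0\<close> keep all arguments of \<open>\<Gamma>\<close> positive, the second since \<open>w j\<close> and
  \<open>w k\<close> both have the sign of \<open>w a\<close>. Hence \<open>(u, v) \<mapsto> \<Sum>\<^sub>j c\<^sub>j (u\<^sub>j \<bullet> v\<^sub>j)\<close> is a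
  positive semidefinite bilinear form, and the claim is its Cauchy--Schwarz inequality
  (\<open>weighted_Cauchy_Schwarz_sum\<close>).
\<close>

text \<open>
  Two applications of Cauchy--Schwarz: the one in the inner product space bounds each \<open>u j \<bullet> v j\<close>
  by \<open>norm (u j) * norm (v j)\<close>, and the one for real sums, with the weight split as
  \<open>sqrt (c j) * sqrt (c j)\<close> between the two factors, handles the sum of these products.
\<close>

lemma weighted_Cauchy_Schwarz_sum:
  fixes c :: "'i \<Rightarrow> real" and u v :: "'i \<Rightarrow> 'b :: real_inner"
  assumes c: "\<And>j. j \<in> A \<Longrightarrow> c j \<ge> 0"
  shows "(\<Sum>j\<in>A. c j * (u j \<bullet> v j))\<^sup>2
           \<le> (\<Sum>j\<in>A. c j * (u j \<bullet> u j)) * (\<Sum>j\<in>A. c j * (v j \<bullet> v j))"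
proof -
  have "\<bar>\<Sum>j\<in>A. c j * (u j \<bullet> v j)\<bar> \<le> (\<Sum>j\<in>A. \<bar>c j * (u j \<bullet> v j)\<bar>)"
    by (rule sum_abs)
  also have "\<dots> \<le> (\<Sum>j\<in>A. (sqrt (c j) * norm (u j)) * (sqrt (c j) * norm (v j)))"
  proof (rule sum_mono)
    fix j assume "j \<in> A"
    then have "\<bar>c j * (u j \<bullet> v j)\<bar> \<le> c j * (norm (u j) * norm (v j))"
      using c by (simp add: abs_mult Cauchy_Schwarz_ineq2 mult_left_mono)
    also have "\<dots> = (sqrt (c j) * sqrt (c j)) * (norm (u j) * norm (v j))"
      using c \<open>j \<in> A\<close> by simp
    finally show "\<bar>c j * (u j \<bullet> v j)\<bar> \<le> (sqrt (c j) * norm (u j)) * (sqrt (c j) * norm (v j))"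
      by (simp only: mult_ac)
  qed
  finally have "(\<Sum>j\<in>A. c j * (u j \<bullet> v j))\<^sup>2
      \<le> (\<Sum>j\<in>A. (sqrt (c j) * norm (u j)) * (sqrt (c j) * norm (v j)))\<^sup>2"
    by (rule power2_le_iff_abs_le[THEN iffD2, rotated]) (simp add: sum_nonneg c)
  also have "\<dots> \<le> (\<Sum>j\<in>A. (sqrt (c j) * norm (u j))\<^sup>2) * (\<Sum>j\<in>A. (sqrt (c j) * norm (v j))\<^sup>2)"
    by (rule Cauchy_Schwarz_ineq_sum)
  also have "\<dots> = (\<Sum>j\<in>A. c j * (u j \<bullet> u j)) * (\<Sum>j\<in>A. c j * (v j \<bullet> v j))"
    by (simp add: power_mult_distrib c power2_norm_eq_inner cong: sum.cong)
  finally show ?thesis .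
qed

lemma rising_pos:
  assumes "p > 0" "p + q > 0"
  shows "rising p q > 0"
  using assms by (simp add: rising_def Gamma_real_pos)

theorem theorem3p16:
  fixes a \<alpha> :: real
    and w :: "real \<Rightarrow> real"
    and u v :: "real \<Rightarrow> real ^ 'n"
  assumes "\<alpha> > 0"
    and "\<And>k. k \<in> nats_from a \<Longrightarrow> w k \<noteq> 0"
    and "\<And>k. k \<in> nats_from (a + 1) \<Longrightarrow> w a / w k > 0"
  shows "\<forall>k \<in> nats_from (a + 1).
    (tempered_GL_sum a \<alpha> w (\<lambda>j. u j \<bullet> v j) k)\<^sup>2
      \<le> tempered_GL_sum a \<alpha> w (\<lambda>j. u j \<bullet> u j) k
        * tempered_GL_sum a \<alpha> w (\<lambda>j. v j \<bullet> v j) k"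
proof
  fix k assume k: "k \<in> nats_from (a + 1)"
  have "rising (k - j + 1) (\<alpha> - 1) / Gamma \<alpha> * (w j / w k) \<ge> 0"
    if j: "j \<in> {j \<in> nats_from (a + 1). j \<le> k}" for j
  proof -
    have "rising (k - j + 1) (\<alpha> - 1) > 0"
      using j \<open>\<alpha> > 0\<close> by (intro rising_pos) auto
    moreover have "w j / w k > 0"
      using assms(3)[OF k] assms(3)[of j] j by (auto simp: zero_less_divide_iff)
    ultimately show ?thesis
      using \<open>\<alpha> > 0\<close> by (intro mult_nonneg_nonneg divide_nonneg_nonneg less_imp_le Gamma_real_pos)
  qed
  then show "(tempered_GL_sum a \<alpha> w (\<lambda>j. u j \<bullet> v j) k)\<^sup>2
      \<le> tempered_GL_sum a \<alpha> w (\<lambda>j. u j \<bullet> u j) k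
        * tempered_GL_sum a \<alpha> w (\<lambda>j. v j \<bullet> v j) k"
    unfolding tempered_GL_sum_eq by (rule weighted_Cauchy_Schwarz_sum)
qed

end
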